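(* Let $m \geq 1$ and $n \geq 1$ be distinct integers, let $R$ be a semiprime ring which is $mn(m+n)|n-m|$-torsion free, and let $F : R \to R$ be a generalized $(m;n)$-Jordan derivation. Then $F$ is a derivation (i.e. $F(xy) = F(x)y + xF(y)$ for all $x,y\in R$) and $F(R) \subseteq Z(R)$.
   Context: All rings are associative. $Z(R)$ denotes the center of $R$. A ring $R$ is semiprime if $aRa = 0$ implies $a = 0$; it is $k$-torsion free if $ka = 0$ implies $a = 0$. For fixed integers $m,n\geq 0$ with $m+n \neq 0$, an additive map $D : R \to R$ is an $(m;n)$-Jordan derivation if $(m+n)D(x^2) = 2mD(x)x + 2nxD(x)$ for all $x \in R$. An additive map $F : R \to R$ is a generalized $(m;n)$-Jordan derivation if there exists an $(m;n)$-Jordan derivation $D : R \to R$ such that $(m+n)F(x^2) = 2mF(x)x + 2nxD(x)$ for all $x \in R$. *)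

theory Defs
  imports Main
begin

text \<open>Rings are associative, not necessarily unital: type class ring.
  Natural-number multiples k a = a + ... + a (k times).\<close>

primrec nsm :: "nat \<Rightarrow> 'a::ab_group_add \<Rightarrow> 'a" where
  "nsm 0 a = 0"
| "nsm (Suc k) a = a + nsm k a"

definition center :: "'a::ring set" where
  "center = {z. \<forall>x. z * x = x * z}"

definition semiprime :: "'a::ring itself \<Rightarrow> bool" where
  "semiprime _ \<longleftrightarrow> (\<forall>a::'a. (\<forall>r. a * r * a = 0) \<longrightarrow> a = 0)"

definition torsion_free :: "'a::ring itself \<Rightarrow> nat \<Rightarrow> bool" where
  "torsion_free _ k \<longleftrightarrow> (\<forall>a::'a. nsm k a = 0 \<longrightarrow> a = 0)"

definition additive :: "('a::ring \<Rightarrow> 'a) \<Rightarrow> bool" where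
  "additive f \<longleftrightarrow> (\<forall>x y. f (x + y) = f x + f y)"

definition mn_jordan_derivation :: "nat \<Rightarrow> nat \<Rightarrow> ('a::ring \<Rightarrow> 'a) \<Rightarrow> bool" where
  "mn_jordan_derivation m n D \<longleftrightarrow> m + n \<noteq> 0 \<and> additive D \<and>
     (\<forall>x. nsm (m + n) (D (x * x)) = nsm (2 * m) (D x * x) + nsm (2 * n) (x * D x))"

definition gen_mn_jordan_derivation :: "nat \<Rightarrow> nat \<Rightarrow> ('a::ring \<Rightarrow> 'a) \<Rightarrow> bool" where
  "gen_mn_jordan_derivation m n F \<longleftrightarrow> m + n \<noteq> 0 \<and> additive F \<and>
     (\<exists>D. mn_jordan_derivation m n D \<and>
        (\<forall>x. nsm (m + n) (F (x * x)) = nsm (2 * m) (F x * x) + nsm (2 * n) (x * D x)))"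

definition derivation :: "('a::ring \<Rightarrow> 'a) \<Rightarrow> bool" where
  "derivation F \<longleftrightarrow> additive F \<and> (\<forall>x y. F (x * y) = F x * y + x * F y)"

end

theory Submission
  imports Defs
begin

text \<open>
  Write \<open>d = D x\<close> and let a prime denote the commutator with \<open>x\<close>. Evaluating \<open>D\<close> on both sides
  of the Jordan identity \<open>(x\<^sup>2 \<circ> y) \<circ> x = x\<^sup>2 \<circ> (y \<circ> x)\<close> eliminates \<open>D y\<close> and leaves the
  generalized polynomial identity
  \<open>n(m+n) y'' d - m(m+n) d y'' + 2mn [y, d']' = 0\<close> in \<open>y\<close>.
  In a prime ring it forces \<open>d' = 0\<close> unless \<open>x\<close> is a central element plus one of square zero, and in
  the latter case \<open>w''' = 0\<close> for all \<open>w\<close>; the semiprime form of this alternative is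
  \<open>d' R w''' = 0\<close>. Linearizing in \<open>x\<close> decouples the two factors, so an Engel argument modulo the
  annihilator of \<open>d'\<close> gives \<open>d' = 0\<close>. The same decoupling then yields \<open>D(x) R [y, z] = 0\<close>,
  hence \<open>D\<close> is central and a derivation.
  For \<open>G = F - D\<close> the same Jordan identity gives
  \<open>(m+n) G(x)(x\<^sup>2 y + y x\<^sup>2) = 2m G(x) x y x\<close>, whence \<open>G(x) R x\<^sup>2 = 0\<close> and finally \<open>G = 0\<close>.
\<close>

section \<open>Integer multiples and torsion\<close>

notation nsm (infixr "\<cdot>" 75)

lemma nsm_add_left: "(k + l) \<cdot> a = k \<cdot> a + l \<cdot> (a::'a::ab_group_add)"
  by (induction k) (simp_all add: algebra_simps)

lemma nsm_add_right: "k \<cdot> (a + b) = k \<cdot> a + k \<cdot> (b::'a::ab_group_add)"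
  by (induction k) (simp_all add: algebra_simps)

lemma nsm_zero_right [simp]: "k \<cdot> (0::'a::ab_group_add) = 0"
  by (induction k) simp_all

lemma nsm_minus_right: "k \<cdot> (- a) = - (k \<cdot> (a::'a::ab_group_add))"
  by (induction k) (simp_all add: algebra_simps)

lemma nsm_diff_right: "k \<cdot> (a - b) = k \<cdot> a - k \<cdot> (b::'a::ab_group_add)"
  by (induction k) (simp_all add: algebra_simps)

lemma nsm_nsm: "(k * l) \<cdot> a = k \<cdot> l \<cdot> (a::'a::ab_group_add)"
  by (induction k) (simp_all add: nsm_add_left)

lemma nsm_commute: "k \<cdot> l \<cdot> a = l \<cdot> k \<cdot> (a::'a::ab_group_add)"
  by (metis nsm_nsm mult.commute)

lemma nsm_mult_left: "(k \<cdot> a) * b = k \<cdot> (a * (b::'a::ring))"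
  by (induction k) (simp_all add: algebra_simps)

lemma nsm_mult_right: "a * (k \<cdot> b) = k \<cdot> (a * (b::'a::ring))"
  by (induction k) (simp_all add: algebra_simps)

lemma nsm_two: "2 \<cdot> a = a + (a::'a::ab_group_add)"
  by (simp add: numeral_eq_Suc)

lemmas nsm_simps = nsm_add_left nsm_add_right nsm_minus_right nsm_diff_right nsm_nsm
  nsm_mult_left nsm_mult_right nsm_two

lemmas nsm_algebra = nsm_simps nsm_commute algebra_simps

lemma additive_zero: "additive f \<Longrightarrow> f 0 = (0::'a::ring)"
proof -
  assume "additive f"
  then have "f (0 + 0) = f 0 + f 0" unfolding additive_def by blast
  then show ?thesis by simp
qed

lemma additive_diff: "additive f \<Longrightarrow> f (a - b) = f a - f (b::'a::ring)"
proof -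
  assume "additive f"
  then have "f ((a - b) + b) = f (a - b) + f b" unfolding additive_def by blast
  then show ?thesis by simp
qed

text \<open>Subtracting the smaller multiple leaves \<open>|n - m|\<close> copies of
  \<open>a\<close>. As \<open>nsm\<close> has only natural coefficients, every later factor
  \<open>n - m\<close> is cancelled in this form.\<close>

lemma nsm_eq_imp_zero:
  fixes a :: "'a::ring"
  assumes tf: "torsion_free TYPE('a) (nat \<bar>int n - int m\<bar>)" and "m \<cdot> a = n \<cdot> a"
  shows "a = 0"
proof -
  have "k \<cdot> a = 0" if "i = j + k" "i \<cdot> a = j \<cdot> a" for i j k
    using that by (simp add: nsm_add_left)
  moreover have "n = m + nat \<bar>int n - int m\<bar> \<or> m = n + nat \<bar>int n - int m\<bar>" by linarith
  ultimately have "nat \<bar>int n - int m\<bar> \<cdot> a = 0" using assms(2) by metis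
  then show ?thesis using tf unfolding torsion_free_def by blast
qed

lemma torsion_free_dvd:
  assumes "torsion_free TYPE('a::ring) k" "l dvd k"
  shows "torsion_free TYPE('a) l"
proof -
  obtain j where "k = j * l" using assms(2) by (metis dvd_def mult.commute)
  then show ?thesis using assms(1) by (auto simp: torsion_free_def nsm_nsm)
qed

text \<open>This makes \<open>R\<close> 2- and 3-torsion free, for every choice of \<open>m\<close> and \<open>n\<close>.\<close>

lemma six_dvd_torsion_number: "6 dvd m * n * (m + n) * nat \<bar>int n - int m\<bar>"
proof -
  have "int (m * n * (m + n) * nat \<bar>int n - int m\<bar>)
      = \<bar>int m * int n * (int m + int n) * (int n - int m)\<bar>"
    by (simp add: abs_mult)
  moreover have "(6::int) dvd a * b * (a + b) * (b - a)" for a b :: int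
  proof -
    have "a mod 6 \<in> {0,1,2,3,4,5}" "b mod 6 \<in> {0,1,2,3,4,5}" by auto
    then have "(a mod 6) * (b mod 6) * (a mod 6 + b mod 6) * (b mod 6 - a mod 6) mod 6 = 0"
      by (elim insertE emptyE) simp_all
    moreover have "a * b * (a + b) * (b - a) mod 6
        = (a mod 6) * (b mod 6) * (a mod 6 + b mod 6) * (b mod 6 - a mod 6) mod 6"
      by (intro mod_mult_cong mod_add_cong mod_diff_cong) simp_all
    ultimately show ?thesis by (simp only: dvd_eq_mod_eq_0)
  qed
  ultimately have "int 6 dvd int (m * n * (m + n) * nat \<bar>int n - int m\<bar>)"
    by (simp only: dvd_abs_iff of_nat_numeral)
  then show ?thesis by (simp only: int_dvd_int_iff)
qed

section \<open>Commutators as inner derivations\<close>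

text \<open>The sign is opposite to that of the usual adjoint map: this is the derivation
  \<open>[_, x]\<close> that a prime denotes.\<close>

definition ad :: "'a::ring \<Rightarrow> 'a \<Rightarrow> 'a" where
  "ad x y = y * x - x * y"

lemma ad_mult: "ad x (y * z) = ad x y * z + y * ad x z"
  by (simp add: ad_def algebra_simps)

lemma ad_add: "ad x (y + z) = ad x y + ad x z"
  by (simp add: ad_def algebra_simps)

lemma ad_diff: "ad x (y - z) = ad x y - ad x z"
  by (simp add: ad_def algebra_simps)

lemma ad_minus: "ad x (- y) = - ad x y"
  by (simp add: ad_def algebra_simps)

lemma ad_nsm: "ad x (k \<cdot> y) = k \<cdot> ad x y"
  by (simp add: ad_def nsm_algebra)

lemma ad_self [simp]: "ad x x = 0"
  by (simp add: ad_def)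

lemma ad_zero [simp]: "ad x 0 = 0"
  by (simp add: ad_def)

lemmas ad_simps = ad_mult ad_add ad_diff ad_minus ad_nsm

lemma ad_left_add: "ad (x + z) y = ad x y + ad z y"
  by (simp add: ad_def algebra_simps)

lemma ad_left_diff: "ad (x - z) y = ad x y - ad z y"
  by (simp add: ad_def algebra_simps)

lemma ad_left_mult: "ad (x * z) y = x * ad z y + ad x y * z"
  by (simp add: ad_def algebra_simps)

section \<open>Cancellation in a semiprime ring with the given torsion\<close>

text \<open>Torsion freeness is split into the divisors that get cancelled later; the divisor 6
  supplies 2 and 3.\<close>

locale torsion_free_semiprime =
  fixes m n :: nat and ring_type :: "'a::ring itself"
  assumes semiprime: "semiprime TYPE('a)"
    and tf_m: "torsion_free TYPE('a) m" and tf_n: "torsion_free TYPE('a) n"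
    and tf_add: "torsion_free TYPE('a) (m + n)"
    and tf_diff: "torsion_free TYPE('a) (nat \<bar>int n - int m\<bar>)"
    and tf_six: "torsion_free TYPE('a) 6"
begin

lemma semiprimeD: "(\<And>r. a * r * a = 0) \<Longrightarrow> a = (0::'a)"
  using semiprime unfolding semiprime_def by blast

lemma m_cancel: "m \<cdot> a = 0 \<Longrightarrow> a = (0::'a)"
  using tf_m unfolding torsion_free_def by blast

lemma n_cancel: "n \<cdot> a = 0 \<Longrightarrow> a = (0::'a)"
  using tf_n unfolding torsion_free_def by blast

lemma add_cancel: "m \<cdot> a + n \<cdot> a = 0 \<Longrightarrow> a = (0::'a)"
  using tf_add unfolding torsion_free_def nsm_add_left by blast

lemma diff_cancel: "m \<cdot> a = n \<cdot> a \<Longrightarrow> a = (0::'a)"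
  using tf_diff by (rule nsm_eq_imp_zero)

lemma two_cancel: "a + a = 0 \<Longrightarrow> a = (0::'a)"
proof -
  assume "a + a = 0"
  then have "2 \<cdot> a = 0" by (simp add: numeral_eq_Suc)
  moreover have "torsion_free TYPE('a) 2" by (rule torsion_free_dvd[OF tf_six]) simp
  ultimately show ?thesis unfolding torsion_free_def by blast
qed

lemma three_cancel: "a + a + a = 0 \<Longrightarrow> a = (0::'a)"
proof -
  assume "a + a + a = 0"
  then have "3 \<cdot> a = 0" by (simp add: numeral_eq_Suc add.assoc)
  moreover have "torsion_free TYPE('a) 3" by (rule torsion_free_dvd[OF tf_six]) simp
  ultimately show ?thesis unfolding torsion_free_def by blast
qed

lemma annihilator_sym:
  assumes "\<And>r. a * r * b = (0::'a)"
  shows "b * r * a = 0"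
proof (rule semiprimeD)
  fix s
  have "b * r * a * s * (b * r * a) = b * r * (a * s * b) * (r * a)" by (simp only: mult.assoc)
  then show "b * r * a * s * (b * r * a) = 0" by (simp add: assms)
qed

section \<open>The difference of \<open>F\<close> and \<open>D\<close>\<close>

text \<open>Taking \<open>x\<close>, \<open>x * x * y\<close> and \<open>x * y\<close> for
  \<open>y\<close> yields in turn \<open>a x^3 = 0\<close>, \<open>a x^2 = 0\<close> and
  \<open>a x y x^2 = 0\<close>. What survives is \<open>(m+n) a y x^2 = 2m a x y x\<close>, whose
  right side generates a nilpotent ideal.\<close>

lemma square_eigen_absorb:
  fixes a x :: 'a
  assumes eq: "\<And>y. m \<cdot> (a * (x * x * y + y * x * x)) + n \<cdot> (a * (x * x * y + y * x * x))
      = m \<cdot> (a * x * y * x) + m \<cdot> (a * x * y * x)"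
  shows "a * y * (x * x) = 0"
proof -
  have "n \<cdot> (a * x * x * x) + n \<cdot> (a * x * x * x) = 0"
    using eq[of x] by (simp add: nsm_algebra)
  then have x3: "a * x * x * x = 0" using n_cancel two_cancel by blast
  have x3': "a * (x * (x * x)) = 0" "a * (x * (x * (x * u))) = 0" for u
    using x3 by (simp_all only: mult.assoc[symmetric]) simp
  have "m \<cdot> (a * x * x * y * x * x) + n \<cdot> (a * x * x * y * x * x) = 0" for y
    using eq[of "x * x * y"] by (simp add: nsm_algebra x3')
  then have "a * x * x * y * x * x = 0" for y using add_cancel by blast
  then have "x * x * y * (a * x * x) = 0" for y
    using annihilator_sym[of "a * x * x" "x * x"] by (simp add: mult.assoc)
  then have "a * (x * x * y * (a * x * x)) = 0" for y by simp
  then have x2: "a * x * x = 0" using semiprimeD[of "a * x * x"] by (simp add: mult.assoc)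
  have x2': "a * (x * x) = 0" "a * (x * (x * u)) = 0" for u
    using x2 by (simp_all only: mult.assoc[symmetric]) simp
  have "m \<cdot> (a * x * y * x * x) + n \<cdot> (a * x * y * x * x) = 0" for y
    using eq[of "x * y"] by (simp add: nsm_algebra x2')
  then have xyx2: "a * x * y * x * x = 0" for y using add_cancel by blast
  have eq': "m \<cdot> (a * y * x * x) + n \<cdot> (a * y * x * x) = m \<cdot> (a * x * y * x) + m \<cdot> (a * x * y * x)" for y
    using eq[of y] by (simp add: nsm_algebra x2')
  have "a * x * y * x = 0" for y
  proof (rule semiprimeD)
    fix r
    \<comment> \<open>For the argument \<open>y x r a x y\<close>, the left side of
      \<open>eq'\<close> ends in \<open>a x y x^2 = 0\<close>, while the right side is
      \<open>2m (a x y x) r (a x y x)\<close>.\<close>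
    have "a * y * x * r * a * x * y * x * x = 0"
      using arg_cong[OF xyx2[of y], of "\<lambda>t. a * y * x * r * t"] by (simp add: mult.assoc)
    then have "m \<cdot> (a * x * y * x * r * (a * x * y * x)) + m \<cdot> (a * x * y * x * r * (a * x * y * x)) = 0"
      using eq'[of "y * x * r * a * x * y"] by (simp add: mult.assoc)
    then show "a * x * y * x * r * (a * x * y * x) = 0" using m_cancel two_cancel by blast
  qed
  then have "m \<cdot> (a * y * x * x) + n \<cdot> (a * y * x * x) = 0" using eq' by simp
  then show ?thesis using add_cancel[of "a * y * x * x"] by (simp add: mult.assoc)
qed

text \<open>After linearization, neighbouring factors to the right of \<open>a * r\<close>
  anticommute. Moving \<open>x\<close> past \<open>z * w\<close> in one exchange or in two gives
  opposite signs, so all products \<open>a r x z w\<close> vanish.\<close>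

lemma annihilates_squares_imp_zero:
  fixes a :: 'a
  assumes "\<And>r x. a * r * (x * x) = 0"
  shows "a = 0"
proof -
  have lin: "a * r * (x * z) = - (a * r * (z * x))" for r x z
  proof -
    have "a * r * (x * z) + a * r * (z * x)
        = a * r * ((x + z) * (x + z)) - a * r * (x * x) - a * r * (z * z)"
      by (simp add: algebra_simps)
    then show ?thesis by (simp add: assms eq_neg_iff_add_eq_0)
  qed
  have 0: "a * r * x * z * w = 0" for r x z w
  proof -
    have "a * r * x * z * w = - (a * r * (z * w * x))" using lin[of r x "z * w"] by (simp add: mult.assoc)
    also have "\<dots> = a * r * z * x * w" using lin[of "r * z" w x] by (simp add: mult.assoc)
    also have "\<dots> = - (a * r * x * z * w)"
      using arg_cong[OF lin[of r z x], of "\<lambda>t. t * w"] by (simp add: mult.assoc)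
    finally show ?thesis by (rule two_cancel[OF iffD1[OF eq_neg_iff_add_eq_0]])
  qed
  have "a * r * a = 0" for r
    by (rule semiprimeD) (use 0 in \<open>simp add: mult.assoc[symmetric]\<close>)
  then show ?thesis by (rule semiprimeD)
qed

lemma additive_left_eigen_zero:
  fixes g :: "'a \<Rightarrow> 'a"
  assumes add: "additive g"
    and sq: "\<And>x. (m + n) \<cdot> g (x * x) = (2 * m) \<cdot> (g x * x)"
  shows "g x = 0"
proof -
  have ga: "g (u + v) = g u + g v" for u v using add by (simp add: additive_def)
  have lin: "(m + n) \<cdot> g (u * v + v * u) = (2 * m) \<cdot> (g u * v + g v * u)" for u v
  proof -
    have "(m + n) \<cdot> g (u * v + v * u)
        = (m + n) \<cdot> g ((u + v) * (u + v)) - (m + n) \<cdot> g (u * u) - (m + n) \<cdot> g (v * v)"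
      by (simp add: ga nsm_algebra)
    then show ?thesis unfolding sq by (simp add: ga nsm_algebra)
  qed
  have key: "m \<cdot> (g x * (x * x * y + y * x * x)) + n \<cdot> (g x * (x * x * y + y * x * x))
      = m \<cdot> (g x * x * y * x) + m \<cdot> (g x * x * y * x)" for x y
  proof -
    let ?A = "g (x * x)" let ?B = "g (x * x * y + y * (x * x))" let ?C = "g (x * y + y * x)"
    define X where "X = (m + n) \<cdot> (g x * (x * x * y + y * x * x)) - (2 * m) \<cdot> (g x * x * y * x)"
    have A: "(m + n) \<cdot> ?A = (2 * m) \<cdot> (g x * x)" by (rule sq)
    have B: "(m + n) \<cdot> ?B = (2 * m) \<cdot> (?A * y + g y * (x * x))" by (rule lin)
    have C: "(m + n) \<cdot> ?C = (2 * m) \<cdot> (g x * y + g y * x)" by (rule lin)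
    \<comment> \<open>Both sides are \<open>(x^2 o y) o x = x^2 o (y o x)\<close>. Applying
      \<open>g\<close> and multiplying by \<open>(m+n)^2\<close> makes the terms in
      \<open>g y\<close> cancel; the rest is \<open>(n-m) X\<close>.\<close>
    have "(x * x * y + y * (x * x)) * x + x * (x * x * y + y * (x * x))
        = x * x * (x * y + y * x) + (x * y + y * x) * (x * x)" by (simp add: algebra_simps)
    then have "(2 * m) \<cdot> (?B * x + g x * (x * x * y + y * (x * x)))
        = (2 * m) \<cdot> (?A * (x * y + y * x) + ?C * (x * x))"
      using lin[of "x * x * y + y * (x * x)" x] lin[of "x * x" "x * y + y * x"] by metis
    then have "2 \<cdot> m \<cdot> (?B * x + g x * (x * x * y + y * (x * x))
        - (?A * (x * y + y * x) + ?C * (x * x))) = 0"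
      by (simp only: nsm_nsm nsm_diff_right) simp
    then have J: "?B * x + g x * (x * x * y + y * (x * x)) = ?A * (x * y + y * x) + ?C * (x * x)"
      unfolding nsm_two by (rule iffD1[OF right_minus_eq m_cancel[OF two_cancel]])
    have "(m + n) \<cdot> (m + n) \<cdot> (?B * x) = (m + n) \<cdot> ((m + n) \<cdot> ?B) * x"
      by (simp only: nsm_mult_left)
    also have "\<dots> = (2 * m) \<cdot> (((m + n) \<cdot> ?A) * y * x + (m + n) \<cdot> (g y * x * x * x))"
      unfolding B by (simp add: nsm_algebra)
    finally have B2: "(m + n) \<cdot> (m + n) \<cdot> (?B * x)
      = (2 * m) \<cdot> ((2 * m) \<cdot> (g x * x) * y * x + (m + n) \<cdot> (g y * x * x * x))" unfolding A .
    have A2: "(m + n) \<cdot> (m + n) \<cdot> (?A * (x * y + y * x))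
       = (m + n) \<cdot> (2 * m) \<cdot> (g x * x) * (x * y + y * x)"
      by (simp only: A nsm_mult_left[symmetric])
    have C2: "(m + n) \<cdot> (m + n) \<cdot> (?C * (x * x)) = (m + n) \<cdot> (2 * m) \<cdot> (g x * y + g y * x) * (x * x)"
      by (simp only: C nsm_mult_left[symmetric])
    have "n \<cdot> X - m \<cdot> X
      = (2 * m) \<cdot> ((2 * m) \<cdot> (g x * x) * y * x + (m + n) \<cdot> (g y * x * x * x))
        + (m + n) \<cdot> (m + n) \<cdot> (g x * (x * x * y + y * (x * x)))
        - ((m + n) \<cdot> (2 * m) \<cdot> (g x * x) * (x * y + y * x)
          + (m + n) \<cdot> (2 * m) \<cdot> (g x * y + g y * x) * (x * x))"
      unfolding X_def by (simp add: nsm_algebra)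
    also have "\<dots> = (m + n) \<cdot> (m + n) \<cdot> (?B * x + g x * (x * x * y + y * (x * x)))
        - (m + n) \<cdot> (m + n) \<cdot> (?A * (x * y + y * x) + ?C * (x * x))"
      unfolding A2[symmetric] B2[symmetric] C2[symmetric] by (simp only: nsm_add_right)
    also have "\<dots> = 0" unfolding J by simp
    finally have "m \<cdot> X = n \<cdot> X" by simp
    then have "X = 0" by (rule diff_cancel)
    then show ?thesis unfolding X_def by (simp add: nsm_simps)
  qed
  have 0: "g x * r * (x * x) = 0" for x r
    by (rule square_eigen_absorb) (rule key)
  have "g y * r * (x * x) = 0" for x y r
  proof (rule semiprimeD)
    fix s
    \<comment> \<open>Subtracting the instance at \<open>x - y\<close> from the one at
      \<open>x + y\<close> isolates the part linear in \<open>x\<close> and the part quadratic in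
      \<open>x\<close> correctly paired: \<open>g y r x^2 + g x r (x y + y x) = 0\<close>.\<close>
    have p: "g (x + y) * r * ((x + y) * (x + y)) = 0" and q: "g (x - y) * r * ((x - y) * (x - y)) = 0"
      by (rule 0)+
    have gd: "g (x - y) = g x - g y" using add by (rule additive_diff)
    have "(g y * r * (x * x) + g x * r * (x * y + y * x))
          + (g y * r * (x * x) + g x * r * (x * y + y * x))
        = g (x + y) * r * ((x + y) * (x + y)) - g (x - y) * r * ((x - y) * (x - y))
          - g y * r * (y * y) - g y * r * (y * y)"
      unfolding ga gd by (simp add: algebra_simps)
    then have eq: "g y * r * (x * x) = - (g x * r * (x * y + y * x))"
      unfolding p q 0[of y] eq_neg_iff_add_eq_0 diff_zero by (rule two_cancel)
    \<comment> \<open>The arbitrary \<open>t\<close> confines the rewriting by \<open>eq\<close> to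
      the right factor of the square; the factor \<open>x x s g(x) = 0\<close> then appears.\<close>
    have "t * s * (g y * r * (x * x)) = - (t * s * g x * r * (x * y + y * x))" for t
      unfolding eq by (simp add: mult.assoc)
    from this[of "g y * r * (x * x)"] have "g y * r * (x * x) * s * (g y * r * (x * x))
        = - (g y * r * (x * x * s * g x) * r * (x * y + y * x))" by (simp only: mult.assoc)
    also have "\<dots> = 0" using annihilator_sym[of "g x" "x * x" s] 0[of x] by simp
    finally show "g y * r * (x * x) * s * (g y * r * (x * x)) = 0" .
  qed
  then show ?thesis by (rule annihilates_squares_imp_zero)
qed

section \<open>The generalized polynomial identity and its consequences for one element\<close>

lemma mn_jordan_linearized:
  fixes D :: "'a \<Rightarrow> 'a"
  assumes "mn_jordan_derivation m n D"
  shows "(m + n) \<cdot> D (u * v + v * u) = (2 * m) \<cdot> (D u * v + D v * u) + (2 * n) \<cdot> (u * D v + v * D u)"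
proof -
  have D: "D (a + b) = D a + D b"
    and sq: "(m + n) \<cdot> D (a * a) = (2 * m) \<cdot> (D a * a) + (2 * n) \<cdot> (a * D a)" for a b
    using assms by (simp_all add: mn_jordan_derivation_def additive_def)
  have "(m + n) \<cdot> D (u * v + v * u)
        = (m + n) \<cdot> D ((u + v) * (u + v)) - (m + n) \<cdot> D (u * u) - (m + n) \<cdot> D (v * v)"
    by (simp add: D nsm_algebra)
  then show ?thesis unfolding sq by (simp add: D nsm_algebra)
qed

lemma mn_jordan_gpi:
  fixes D :: "'a \<Rightarrow> 'a"
  assumes jord: "mn_jordan_derivation m n D"
  defines "h x \<equiv> ad x (D x)"
  shows "n \<cdot> (m + n) \<cdot> (ad x (ad x y) * D x) + 2 \<cdot> m \<cdot> n \<cdot> ad x (y * h x - h x * y)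
    = m \<cdot> (m + n) \<cdot> (D x * ad x (ad x y))"
proof -
  note lin = mn_jordan_linearized[OF jord]
  let ?d = "D x" let ?e = "D y"
  let ?W = "x * x * y + y * (x * x)" let ?V = "x * y + y * x"
  let ?A = "D (x * x)" let ?B = "D ?W" let ?C = "D ?V"
  \<comment> \<open>\<open>A\<close>, \<open>B\<close>, \<open>C\<close> are
    \<open>(m+n) D(x^2)\<close>, \<open>(m+n)^2 D(?W)\<close> and \<open>(m+n) D(?V)\<close>
    expressed through \<open>D x\<close> and \<open>D y\<close> alone.\<close>
  define A where "A = (2 * m) \<cdot> (?d * x) + (2 * n) \<cdot> (x * ?d)"
  define B where "B = (2 * m) \<cdot> (A * y + (m + n) \<cdot> (?e * (x * x))) + (2 * n) \<cdot> ((m + n) \<cdot> (x * x * ?e) + y * A)"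
  define C where "C = (2 * m) \<cdot> (?d * y + ?e * x) + (2 * n) \<cdot> (x * ?e + y * ?d)"
  define X where "X = n \<cdot> (m + n) \<cdot> (ad x (ad x y) * ?d) + 2 \<cdot> m \<cdot> n \<cdot> ad x (y * h x - h x * y)
    - m \<cdot> (m + n) \<cdot> (?d * ad x (ad x y))"
  have A: "(m + n) \<cdot> ?A = A"
    using jord unfolding A_def by (simp add: mn_jordan_derivation_def)
  have "(m + n) \<cdot> (m + n) \<cdot> ?B
      = (2 * m) \<cdot> ((m + n) \<cdot> ?A * y + (m + n) \<cdot> (?e * (x * x)))
        + (2 * n) \<cdot> ((m + n) \<cdot> (x * x * ?e) + y * (m + n) \<cdot> ?A)"
    unfolding lin by (simp only: nsm_add_right nsm_mult_left nsm_mult_right nsm_commute[of "m + n" "2 * m"] nsm_commute[of "m + n" "2 * n"])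
  then have B: "(m + n) \<cdot> (m + n) \<cdot> ?B = B" unfolding A B_def .
  have C: "(m + n) \<cdot> ?C = C" unfolding C_def by (rule lin)
  have "?W * x + x * ?W = x * x * ?V + ?V * (x * x)" by (simp add: algebra_simps)
  then have "(2 * m) \<cdot> (?B * x + ?d * ?W) + (2 * n) \<cdot> (?W * ?d + x * ?B)
      = (2 * m) \<cdot> (?A * ?V + ?C * (x * x)) + (2 * n) \<cdot> (x * x * ?C + ?V * ?A)"
    using lin[of ?W x] lin[of "x * x" ?V] by simp
  then have "2 \<cdot> (m \<cdot> (?B * x + ?d * ?W) + n \<cdot> (?W * ?d + x * ?B)
      - (m \<cdot> (?A * ?V + ?C * (x * x)) + n \<cdot> (x * x * ?C + ?V * ?A))) = 0"
    by (simp only: nsm_nsm nsm_add_right[of 2] nsm_diff_right) simp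
  then have J: "m \<cdot> (?B * x + ?d * ?W) + n \<cdot> (?W * ?d + x * ?B)
      = m \<cdot> (?A * ?V + ?C * (x * x)) + n \<cdot> (x * x * ?C + ?V * ?A)"
    unfolding nsm_two by (rule iffD1[OF right_minus_eq two_cancel])
  let ?S = "\<lambda>t. (m + n) \<cdot> (m + n) \<cdot> t"
  have "m \<cdot> (B * x + ?S (?d * ?W)) + n \<cdot> (?S (?W * ?d) + x * B)
      = ?S (m \<cdot> (?B * x + ?d * ?W) + n \<cdot> (?W * ?d + x * ?B))"
    unfolding B[symmetric] nsm_add_right nsm_mult_left nsm_mult_right
      nsm_commute[of "m + n" m] nsm_commute[of "m + n" n] by (rule refl)
  moreover have "m \<cdot> ((m + n) \<cdot> A * ?V + (m + n) \<cdot> C * (x * x))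
        + n \<cdot> (x * x * (m + n) \<cdot> C + ?V * (m + n) \<cdot> A)
      = ?S (m \<cdot> (?A * ?V + ?C * (x * x)) + n \<cdot> (x * x * ?C + ?V * ?A))"
    unfolding A[symmetric] C[symmetric] nsm_add_right nsm_mult_left nsm_mult_right
      nsm_commute[of "m + n" m] nsm_commute[of "m + n" n] by (rule refl)
  \<comment> \<open>All terms in \<open>D y\<close> cancel here, and the coefficients of the others
    share the factor \<open>m - n\<close>.\<close>
  moreover have "m \<cdot> X - n \<cdot> X = m \<cdot> (B * x + ?S (?d * ?W)) + n \<cdot> (?S (?W * ?d) + x * B)
      - (m \<cdot> ((m + n) \<cdot> A * ?V + (m + n) \<cdot> C * (x * x))
        + n \<cdot> (x * x * (m + n) \<cdot> C + ?V * (m + n) \<cdot> A))"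
    unfolding X_def A_def B_def C_def h_def ad_def by (simp add: nsm_algebra)
  ultimately have "m \<cdot> X = n \<cdot> X" unfolding J by simp
  then have "X = 0" by (rule diff_cancel)
  then show ?thesis unfolding X_def by (simp only: right_minus_eq)
qed

text \<open>Leibniz expansion of \<open>a (u v)''\<close> gives
  \<open>2 a u' v' + a u v'' = 0\<close>. Replacing \<open>u\<close> by \<open>u'\<close> kills
  \<open>a u' v''\<close>; replacing \<open>v\<close> by \<open>w'\<close> then leaves only the
  third derivative.\<close>

lemma annihilates_ad2_imp_ad3:
  fixes a x :: 'a
  assumes "\<And>z. a * ad x (ad x z) = 0"
  shows "a * z * ad x (ad x (ad x w)) = 0"
proof -
  have 1: "2 \<cdot> (a * ad x u * ad x v) + a * u * ad x (ad x v) = 0" for u v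
  proof -
    have "2 \<cdot> (a * ad x u * ad x v) + a * u * ad x (ad x v)
        = a * ad x (ad x (u * v)) - a * ad x (ad x u) * v"
      by (simp add: ad_simps nsm_algebra)
    then show ?thesis by (simp add: assms)
  qed
  have 2: "a * ad x u * ad x (ad x v) = 0" for u v
    using 1[of "ad x u" v] by (simp add: assms)
  show ?thesis using 1[of z "ad x w"] by (simp add: 2)
qed

text \<open>Exchanging \<open>h\<close> and \<open>t\<close> costs a factor \<open>m/n\<close>. In
  \<open>h z h w t\<close> it can be done once across \<open>z h w\<close>, or twice in succession,
  so \<open>m/n\<close> and \<open>(m/n)^2\<close> agree on \<open>t z h w h\<close>, which must
  vanish.\<close>

lemma eigen_swap_zero:
  fixes h t :: 'a
  assumes eq: "\<And>z. n \<cdot> (h * z * t) = m \<cdot> (t * z * h)"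
  shows "t * z * h = 0"
proof -
  have 0: "t * z * h * w * h = 0" for z w
  proof -
    have "n \<cdot> m \<cdot> (t * z * h * w * h) = n \<cdot> n \<cdot> (h * (z * h * w) * t)"
      unfolding eq by (simp add: mult.assoc)
    also have "\<dots> = n \<cdot> (h * z * (n \<cdot> (h * w * t)))" by (simp add: nsm_mult_right mult.assoc)
    also have "\<dots> = m \<cdot> (n \<cdot> (h * z * t)) * w * h"
      unfolding eq[of w] by (simp add: nsm_mult_right nsm_mult_left mult.assoc nsm_commute)
    also have "\<dots> = m \<cdot> m \<cdot> (t * z * h * w * h)" unfolding eq by (simp add: nsm_mult_left)
    finally have "m \<cdot> (n \<cdot> (t * z * h * w * h) - m \<cdot> (t * z * h * w * h)) = 0"
      by (simp add: nsm_diff_right nsm_commute)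
    then have "n \<cdot> (t * z * h * w * h) - m \<cdot> (t * z * h * w * h) = 0" by (rule m_cancel)
    then show ?thesis by (rule_tac diff_cancel) simp
  qed
  show ?thesis
  proof (rule semiprimeD)
    fix r
    have "n \<cdot> (t * z * h * r * (t * z * h)) = t * z * (n \<cdot> (h * r * t)) * z * h"
      by (simp add: nsm_mult_right nsm_mult_left mult.assoc)
    also have "\<dots> = m \<cdot> (t * z * (t * r * h * z * h))"
      unfolding eq by (simp add: nsm_mult_right nsm_mult_left mult.assoc)
    finally show "t * z * h * r * (t * z * h) = 0" unfolding 0 by (rule_tac n_cancel) simp
  qed
qed

text \<open>The identity \<open>e\<close>, its derivative \<open>e1\<close> and its second-order
  defect \<open>G\<close> are evaluated at special arguments. They kill in turn \<open>k'\<close>,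
  \<open>t\<close>, \<open>h h\<close>, \<open>h k\<close> and \<open>k h\<close>, then
  \<open>k\<close> itself, then \<open>h z' h\<close> and finally \<open>h z''\<close>.\<close>

lemma gpi_imp_annihilates_ad2:
  fixes d x :: 'a
  defines "h \<equiv> ad x d"
  assumes gpi: "\<And>y. n \<cdot> (m + n) \<cdot> (ad x (ad x y) * d) + 2 \<cdot> m \<cdot> n \<cdot> ad x (y * h - h * y)
    = m \<cdot> (m + n) \<cdot> (d * ad x (ad x y))"
  shows "h * ad x (ad x z) = 0"
proof -
  define \<delta> where "\<delta> = ad x"
  define k where "k = \<delta> h"
  have \<delta>: "\<delta> (a * b) = \<delta> a * b + a * \<delta> b" "\<delta> (a + b) = \<delta> a + \<delta> b" "\<delta> (a - b) = \<delta> a - \<delta> b"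
    "\<delta> (- a) = - \<delta> a" "\<delta> (j \<cdot> a) = j \<cdot> \<delta> a" "\<delta> 0 = 0" for a b j
    unfolding \<delta>_def by (simp_all add: ad_simps)
  have \<delta>dh: "\<delta> d = h" "\<delta> h = k" by (simp_all add: \<delta>_def h_def k_def)
  define e where "e y = n \<cdot> (m + n) \<cdot> (\<delta> (\<delta> y) * d) + 2 \<cdot> m \<cdot> n \<cdot> \<delta> (y * h - h * y)
    - m \<cdot> (m + n) \<cdot> (d * \<delta> (\<delta> y))" for y
  have e0: "e y = 0" for y using gpi[of y] by (simp add: e_def \<delta>_def)
  have \<delta>k: "\<delta> k = 0"
  proof -
    have "x * h - h * x = - k" by (simp add: k_def \<delta>_def ad_def)
    then have "e x = - (2 \<cdot> m \<cdot> n \<cdot> \<delta> k)"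
      by (simp add: e_def \<delta>) (simp add: \<delta>_def nsm_minus_right)
    then have "2 \<cdot> m \<cdot> n \<cdot> \<delta> k = 0" by (simp add: e0)
    then show ?thesis unfolding nsm_two by (rule n_cancel[OF m_cancel[OF two_cancel]])
  qed
  note \<delta>s = \<delta> \<delta>dh \<delta>k
  \<comment> \<open>This is \<open>e\<close> with its coefficients \<open>d\<close> and
    \<open>h\<close> differentiated to \<open>h\<close> and \<open>k\<close>; \<open>k' = 0\<close>
    removes one further term.\<close>
  define e1 where "e1 y = n \<cdot> (m + n) \<cdot> (\<delta> (\<delta> y) * h) + 2 \<cdot> m \<cdot> n \<cdot> (\<delta> y * k - k * \<delta> y)
    - m \<cdot> (m + n) \<cdot> (h * \<delta> (\<delta> y))" for y
  have e10: "e1 y = 0" for y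
  proof -
    have "e1 y = \<delta> (e y) - e (\<delta> y)" by (simp add: e_def e1_def \<delta>s nsm_algebra)
    then show ?thesis by (simp add: e0 \<delta>)
  qed
  \<comment> \<open>the second-order defect \<open>e(yzw) - e(yz)w - y e(zw) + y e(z) w\<close> at \<open>y = d\<close>\<close>
  define G where "G z w = n \<cdot> (m + n) \<cdot> (k * z * (w * d - d * w)) + 2 \<cdot> n \<cdot> (m + n) \<cdot> (h * \<delta> z * (w * d - d * w))
    + 2 \<cdot> n \<cdot> (m + n) \<cdot> (h * z * \<delta> w * d) - 2 \<cdot> m \<cdot> (m + n) \<cdot> (d * h * z * \<delta> w)
    + 2 \<cdot> m \<cdot> n \<cdot> (h * z * (w * h - h * w) + (d * h - h * d) * z * \<delta> w)" for z w
  have G0: "G z w = 0" for z w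
  proof -
    have "G z w = e (d * z * w) - e (d * z) * w - d * e (z * w) + d * e z * w"
      by (simp add: e_def G_def \<delta>s nsm_algebra)
    then show ?thesis by (simp add: e0)
  qed
  \<comment> \<open>At \<open>w = d\<close> the commutators of \<open>w\<close> with
    \<open>d\<close> in \<open>G\<close> vanish, and the remaining terms factor as
    \<open>2 (n h z t - m t z h)\<close>.\<close>
  define t where "t = m \<cdot> (d * h) + n \<cdot> (h * d)"
  have t0: "t = 0"
  proof -
    have "n \<cdot> (h * z * t) = m \<cdot> (t * z * h)" for z
    proof -
      have "(n \<cdot> (h * z * t) - m \<cdot> (t * z * h)) + (n \<cdot> (h * z * t) - m \<cdot> (t * z * h)) = G z d"
        by (simp add: G_def t_def \<delta>s nsm_algebra)
      then show ?thesis unfolding G0 by (rule iffD1[OF right_minus_eq two_cancel])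
    qed
    then have tzh: "t * z * h = 0" for z by (rule eigen_swap_zero)
    have "t * z * t = m \<cdot> (t * (z * d) * h) + n \<cdot> (t * z * h * d)" for z
      unfolding t_def by (simp only: distrib_left nsm_mult_right mult.assoc)
    then show ?thesis by (rule_tac semiprimeD) (simp add: tzh)
  qed
  \<comment> \<open>\<open>e d\<close> equals \<open>(n-m) u\<close>, and differentiating
    \<open>t = 0\<close> gives \<open>(m+n) h h + u = 0\<close>.\<close>
  define u where "u = n \<cdot> (k * d) + m \<cdot> (d * k)"
  have u0: "u = 0"
  proof -
    have "n \<cdot> u - m \<cdot> u = e d" by (simp add: e_def u_def \<delta>s nsm_algebra)
    then show ?thesis by (rule_tac diff_cancel) (simp add: e0)
  qed
  have hh: "h * h = 0"
  proof -
    have "m \<cdot> (h * h) + n \<cdot> (h * h) = \<delta> t - u" by (simp add: t_def u_def \<delta>s nsm_algebra)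
    then show ?thesis by (rule_tac add_cancel) (simp add: t0 u0 \<delta>)
  qed
  \<comment> \<open>\<open>e1 d\<close> equals \<open>(n-m) v\<close>; the derivative of
    \<open>h h = 0\<close> is a second relation between \<open>h k\<close> and
    \<open>k h\<close>.\<close>
  define v where "v = n \<cdot> (k * h) + m \<cdot> (h * k)"
  have v0: "v = 0"
  proof -
    have "n \<cdot> v - m \<cdot> v = e1 d" by (simp add: e1_def v_def \<delta>s nsm_algebra)
    then show ?thesis by (rule_tac diff_cancel) (simp add: e10)
  qed
  have "m \<cdot> (h * k) - n \<cdot> (h * k) = v - n \<cdot> \<delta> (h * h)" by (simp add: v_def \<delta>s nsm_algebra)
  then have hk: "h * k = 0" by (rule_tac diff_cancel) (simp add: v0 hh \<delta>)
  have "k * h = \<delta> (h * h) - h * k" by (simp add: \<delta>s)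
  then have kh: "k * h = 0" by (simp add: hh hk \<delta>)
  have zeros: "h * (h * a) = 0" "h * (k * a) = 0" "k * (h * a) = 0" for a
    by (simp_all only: mult.assoc[symmetric] hh hk kh) simp_all
  \<comment> \<open>The terms of \<open>G\<close> that begin with \<open>d h\<close> or
    \<open>h d\<close> add up to \<open>-2m t z w'\<close>, which is zero; the others are
    \<open>n\<close> times \<open>i\<close>.\<close>
  define i where "i z w = (m + n) \<cdot> ((k * z + 2 \<cdot> (h * \<delta> z)) * (w * d - d * w))
    + h * z * (2 \<cdot> (m + n) \<cdot> (\<delta> w * d) + 2 \<cdot> m \<cdot> (w * h - h * w))" for z w
  have i0: "i z w = 0" for z w
  proof -
    have "n \<cdot> i z w = G z w + 2 \<cdot> m \<cdot> (t * z * \<delta> w)"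
      by (simp add: i_def G_def t_def nsm_algebra)
    then show ?thesis by (rule_tac n_cancel) (simp add: G0 t0)
  qed
  \<comment> \<open>\<open>M\<close> arises from comparing \<open>i (z h r) x\<close> with
    \<open>h z (i r x)\<close>: as \<open>x' = 0\<close> and \<open>x d - d x = -h\<close>, the
    difference is \<open>-(m+n) M(z) r h\<close>.\<close>
  define M where "M z = k * z * h + 2 \<cdot> (h * \<delta> z * h) + h * z * k" for z
  have M0: "M z = 0" for z
  proof -
    have Mh: "M z * r * h = 0" for r
    proof -
      have xd: "x * d - d * x = - h" by (simp add: h_def ad_def)
      have "m \<cdot> (M z * r * (x * d - d * x)) + n \<cdot> (M z * r * (x * d - d * x))
          = i (z * h * r) x - h * z * i r x"
        by (simp add: i_def M_def \<delta>s nsm_algebra)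
      then have "m \<cdot> (M z * r * h) + n \<cdot> (M z * r * h) = 0"
        unfolding xd i0 by (simp add: nsm_minus_right add_eq_0_iff)
      then show ?thesis by (rule add_cancel)
    qed
    have Mk: "M z * r * k = 0" for r
    proof -
      have "M z * r * k = M z * r * h * x - M z * (r * x) * h"
        by (simp add: k_def \<delta>_def ad_def algebra_simps)
      then show ?thesis by (simp add: Mh)
    qed
    have "M z * r * M z = M z * r * k * z * h + 2 \<cdot> (M z * r * h * \<delta> z * h) + M z * r * h * z * k" for r
    proof -
      \<comment> \<open>The left factor is generalized to \<open>a\<close> so that only the
        right-hand \<open>M z\<close> is unfolded.\<close>
      have "a * r * M z = a * r * k * z * h + 2 \<cdot> (a * r * h * \<delta> z * h) + a * r * h * z * k" for a
        by (simp add: M_def nsm_algebra)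
      then show ?thesis .
    qed
    then show ?thesis by (rule_tac semiprimeD) (simp add: Mh Mk)
  qed
  have N0: "k * \<delta> z * h + h * \<delta> z * k + k * z * k = 0" for z
  proof -
    have "(k * \<delta> z * h + h * \<delta> z * k + k * z * k) + (k * \<delta> z * h + h * \<delta> z * k + k * z * k)
        = \<delta> (M z) - M (\<delta> z)" by (simp add: M_def \<delta>s nsm_algebra)
    then show ?thesis by (rule_tac two_cancel) (simp add: M0 \<delta>)
  qed
  have hzk: "h * \<delta> z * k = 0" and kzh: "k * \<delta> z * h = 0" for z
  proof -
    \<comment> \<open>\<open>h e1(z)\<close>, \<open>e1(z) h\<close> and \<open>M(z')\<close> give
      three linear relations between \<open>?a\<close>, \<open>?b\<close> and \<open>?c\<close>.
      Eliminating \<open>?c\<close> leaves \<open>m ?a = n ?b\<close> and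
      \<open>?a = ?b\<close>.\<close>
    let ?a = "h * \<delta> z * k" and ?b = "k * \<delta> z * h" and ?c = "h * \<delta> (\<delta> z) * h"
    have "n \<cdot> ((m + n) \<cdot> ?c + 2 \<cdot> m \<cdot> ?a) = h * e1 z"
      by (simp add: e1_def nsm_algebra zeros)
    then have pa: "(m + n) \<cdot> ?c + 2 \<cdot> m \<cdot> ?a = 0" by (rule_tac n_cancel) (simp add: e10)
    have "m \<cdot> ((m + n) \<cdot> ?c + 2 \<cdot> n \<cdot> ?b) = - (e1 z * h)"
      by (simp add: e1_def nsm_algebra zeros hh hk kh)
    then have pb: "(m + n) \<cdot> ?c + 2 \<cdot> n \<cdot> ?b = 0" by (rule_tac m_cancel) (simp add: e10)
    have "(m \<cdot> ?a - n \<cdot> ?b) + (m \<cdot> ?a - n \<cdot> ?b)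
        = ((m + n) \<cdot> ?c + 2 \<cdot> m \<cdot> ?a) - ((m + n) \<cdot> ?c + 2 \<cdot> n \<cdot> ?b)" by (simp add: nsm_algebra)
    then have mn: "m \<cdot> ?a = n \<cdot> ?b"
      unfolding pa pb diff_zero by (rule iffD1[OF right_minus_eq two_cancel])
    have "n \<cdot> (?a - ?b) - m \<cdot> (?a - ?b)
        = (m + n) \<cdot> M (\<delta> z) - ((m + n) \<cdot> ?c + 2 \<cdot> m \<cdot> ?a) - ((m + n) \<cdot> ?c + 2 \<cdot> n \<cdot> ?b)"
      by (simp add: M_def nsm_algebra)
    then have "n \<cdot> (?a - ?b) - m \<cdot> (?a - ?b) = 0" unfolding pa pb M0 by simp
    then have "?a - ?b = 0" by (rule_tac diff_cancel) simp
    then have ab: "?a = ?b" by simp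
    show "?a = 0" using mn unfolding ab[symmetric] by (rule diff_cancel)
    then show "?b = 0" unfolding ab[symmetric] .
  qed
  have k0: "k = 0"
    by (rule semiprimeD) (use N0 hzk kzh in simp)
  have hzh: "h * \<delta> z * h = 0" for z
    using M0[of z] unfolding M_def k0 by (rule_tac two_cancel) (simp add: nsm_two)
  have hzh': "h * (\<delta> z * h) = 0" "h * (\<delta> z * (h * a)) = 0" for z a
    using hzh[of z] by (simp_all only: mult.assoc[symmetric]) simp
  define l where "l z = n \<cdot> (\<delta> (\<delta> z) * h) - m \<cdot> (h * \<delta> (\<delta> z))" for z
  have l0: "l z = 0" for z
  proof -
    have "m \<cdot> l z + n \<cdot> l z = e1 z" by (simp add: l_def e1_def k0 nsm_algebra)
    then show ?thesis by (rule_tac add_cancel) (simp add: e10)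
  qed
  have hyh: "h * y * h * \<delta> (\<delta> z) = 0" for y z
  proof -
    \<comment> \<open>Two applications of \<open>hzh\<close> and one of \<open>l\<close> give
      \<open>?w = h y z'' h\<close>, whereas \<open>h y l(z) = 0\<close> gives
      \<open>n h y z'' h = m ?w\<close>.\<close>
    let ?w = "h * y * h * \<delta> (\<delta> z)"
    have "h * y * \<delta> (\<delta> z) * h - h * \<delta> (\<delta> y) * z * h = h * \<delta> (y * \<delta> z) * h - h * \<delta> (\<delta> y * z) * h"
      by (simp add: \<delta>s algebra_simps)
    then have 1: "h * \<delta> (\<delta> y) * z * h = h * y * \<delta> (\<delta> z) * h" by (simp add: hzh)
    have "m \<cdot> (?w - h * \<delta> (\<delta> y) * z * h) = l y * z * h - l (y * h * z)"
      by (simp add: l_def \<delta>s k0 nsm_algebra zeros hzh')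
    then have "?w - h * \<delta> (\<delta> y) * z * h = 0" by (rule_tac m_cancel) (simp add: l0)
    then have 2: "?w = h * y * \<delta> (\<delta> z) * h" by (simp add: 1)
    have "n \<cdot> (h * y * \<delta> (\<delta> z) * h) - m \<cdot> ?w = h * y * l z" by (simp add: l_def nsm_algebra)
    then have "n \<cdot> ?w - m \<cdot> ?w = 0" unfolding 2[symmetric] l0 by simp
    then show ?thesis by (rule_tac diff_cancel) simp
  qed
  have "h * \<delta> (\<delta> z) = 0"
  proof (rule semiprimeD)
    fix r show "h * \<delta> (\<delta> z) * r * (h * \<delta> (\<delta> z)) = 0"
      using hyh[of "\<delta> (\<delta> z) * r" z] by (simp only: mult.assoc)
  qed
  then show ?thesis by (simp add: \<delta>_def)
qed

section \<open>Decoupling by interpolation, and an Engel condition\<close>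

text \<open>The hypotheses are the values of \<open>c1 t + c2 t^2 + c3 t^3 + c4 t^4\<close> at
  \<open>1, -1, 2, -2\<close>. Even and odd parts separate, and each leaves a factor 12.\<close>

lemma interpolation_coefficients_zero:
  fixes c1 c2 c3 c4 :: 'a
  assumes p1: "c1 + c2 + c3 + c4 = 0" and n1: "- c1 + c2 - c3 + c4 = 0"
    and p2: "2 \<cdot> c1 + 2 \<cdot> 2 \<cdot> c2 + 2 \<cdot> 2 \<cdot> 2 \<cdot> c3 + 2 \<cdot> 2 \<cdot> 2 \<cdot> 2 \<cdot> c4 = 0"
    and n2: "- (2 \<cdot> c1) + 2 \<cdot> 2 \<cdot> c2 - 2 \<cdot> 2 \<cdot> 2 \<cdot> c3 + 2 \<cdot> 2 \<cdot> 2 \<cdot> 2 \<cdot> c4 = 0"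
  shows "c1 = 0 \<and> c2 = 0 \<and> c3 = 0"
proof -
  have "(c2 + c4) + (c2 + c4) = (c1 + c2 + c3 + c4) + (- c1 + c2 - c3 + c4)"
    by (simp add: algebra_simps)
  then have e: "c2 + c4 = 0" unfolding p1 n1 add_0 by (rule two_cancel)
  have "c1 + c3 = (c1 + c2 + c3 + c4) - (c2 + c4)" by (simp add: algebra_simps)
  then have o: "c1 + c3 = 0" unfolding p1 e by simp
  have c1: "c1 = - c3" and c4: "c4 = - c2" using e o by (simp_all add: eq_neg_iff_add_eq_0 add.commute)
  have "2 \<cdot> 2 \<cdot> (c3 + c3 + c3)
      = (2 \<cdot> c1 + 2 \<cdot> 2 \<cdot> c2 + 2 \<cdot> 2 \<cdot> 2 \<cdot> c3 + 2 \<cdot> 2 \<cdot> 2 \<cdot> 2 \<cdot> c4)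
      - (- (2 \<cdot> c1) + 2 \<cdot> 2 \<cdot> c2 - 2 \<cdot> 2 \<cdot> 2 \<cdot> c3 + 2 \<cdot> 2 \<cdot> 2 \<cdot> 2 \<cdot> c4)"
    unfolding c1 by (simp add: nsm_algebra)
  then have "2 \<cdot> 2 \<cdot> (c3 + c3 + c3) = 0" unfolding p2 n2 by simp
  then have c3: "c3 = 0" unfolding nsm_two by (rule three_cancel[OF two_cancel[OF two_cancel]])
  have "2 \<cdot> 2 \<cdot> (c2 + c2 + c2) = - (2 \<cdot> c1 + 2 \<cdot> 2 \<cdot> c2 + 2 \<cdot> 2 \<cdot> 2 \<cdot> c3 + 2 \<cdot> 2 \<cdot> 2 \<cdot> 2 \<cdot> c4)"
    unfolding c1 c4 c3 by (simp add: nsm_algebra)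
  then have "2 \<cdot> 2 \<cdot> (c2 + c2 + c2) = 0" unfolding p2 by simp
  then have "c2 = 0" unfolding nsm_two by (rule three_cancel[OF two_cancel[OF two_cancel]])
  then show ?thesis using c1 c3 by simp
qed

text \<open>The hypotheses are the four lowest coefficients of \<open>a(t) R b(t)\<close>.
  Multiplying the relation that contains \<open>a0 r b\<close> by \<open>s a0 r b\<close> turns its
  leading term into a square and kills the rest, because the earlier \<open>b'\<close> satisfy
  \<open>b' s a0 = 0\<close>.\<close>

lemma polynomial_annihilator:
  fixes a0 :: 'a
  assumes c0: "\<And>r. a0 * r * b0 = 0" and c1: "\<And>r. a0 * r * b1 + a1 * r * b0 = 0"
    and c2: "\<And>r. a0 * r * b2 + a1 * r * b1 + a2 * r * b0 = 0"
    and c3: "\<And>r. a0 * r * b3 + a1 * r * b2 + a2 * r * b1 = 0"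
  shows "a0 * r * b3 = 0"
proof -
  have step: "a0 * r * b = 0" if eq: "\<And>r. a0 * r * b + a1 * r * b' + a2 * r * b'' = 0"
      and 0: "\<And>r. a0 * r * b' = 0" "\<And>r. a0 * r * b'' = 0" for b b' b'' r
  proof (rule semiprimeD)
    fix s
    have "b' * s * a0 = 0" "b'' * s * a0 = 0" by (rule annihilator_sym[OF 0(1)] annihilator_sym[OF 0(2)])+
    then have "(a0 * r * b + a1 * r * b' + a2 * r * b'') * s * (a0 * r * b) = a0 * r * b * s * (a0 * r * b)"
      by (simp add: distrib_right mult.assoc) (simp add: mult.assoc[symmetric])
    then show "a0 * r * b * s * (a0 * r * b) = 0" unfolding eq by simp
  qed
  have b1: "a0 * r * b1 = 0" for r
    by (rule step[of b1 b0 0]) (use c0 c1 in simp_all)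
  have b2: "a0 * r * b2 = 0" for r
    by (rule step[of b2 b1 b0]) (use c0 c2 b1 in simp_all)
  show ?thesis
    by (rule step[of b3 b2 b1]) (use c3 b1 b2 in simp_all)
qed

text \<open>The hypotheses are \<open>a(t) R T(x + t z) = 0\<close>, where \<open>a(t) = a0 + t a1 + t\<^sup>2 a2\<close>, at
  \<open>t = 0, 1, -1, 2, -2\<close> and at infinity. The total degree in \<open>t\<close> is 5, so these six points suffice
  with 2- and 3-torsion freeness alone.\<close>

lemma ad3_annihilator_decouple:
  fixes x y z :: 'a
  defines "T u \<equiv> ad u (ad u (ad u y))"
  assumes x: "\<And>r. a0 * r * T x = 0" and z: "\<And>r. a2 * r * T z = 0"
    and p1: "\<And>r. (a0 + a1 + a2) * r * T (x + z) = 0"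
    and n1: "\<And>r. (a0 - a1 + a2) * r * T (x - z) = 0"
    and p2: "\<And>r. (a0 + 2 \<cdot> a1 + 2 \<cdot> 2 \<cdot> a2) * r * T (x + (z + z)) = 0"
    and n2: "\<And>r. (a0 - 2 \<cdot> a1 + 2 \<cdot> 2 \<cdot> a2) * r * T (x - (z + z)) = 0"
  shows "a0 * r * T z = 0"
proof -
  define b1 where "b1 = ad z (ad x (ad x y)) + ad x (ad z (ad x y)) + ad x (ad x (ad z y))"
  define b2 where "b2 = ad x (ad z (ad z y)) + ad z (ad x (ad z y)) + ad z (ad z (ad x y))"
  have T: "T (x + z) = T x + b1 + b2 + T z" "T (x - z) = T x - b1 + b2 - T z"
    "T (x + (z + z)) = T x + 2 \<cdot> b1 + 2 \<cdot> 2 \<cdot> b2 + 2 \<cdot> 2 \<cdot> 2 \<cdot> T z"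
    "T (x - (z + z)) = T x - 2 \<cdot> b1 + 2 \<cdot> 2 \<cdot> b2 - 2 \<cdot> 2 \<cdot> 2 \<cdot> T z"
    unfolding T_def b1_def b2_def
    by (simp_all add: ad_left_add ad_left_diff ad_simps nsm_two algebra_simps)
  \<comment> \<open>These are the coefficients of \<open>t\<close>, \<open>t^2\<close> and
    \<open>t^3\<close>; \<open>c4\<close> is that of \<open>t^4\<close>, and those of
    \<open>1\<close> and \<open>t^5\<close> vanish by \<open>x\<close> and \<open>z\<close>.\<close>
  have c: "a0 * r * b1 + a1 * r * T x = 0 \<and> a0 * r * b2 + a1 * r * b1 + a2 * r * T x = 0
    \<and> a0 * r * T z + a1 * r * b2 + a2 * r * b1 = 0" for r
    by (rule interpolation_coefficients_zero[where ?c4.0 = "a1 * r * T z + a2 * r * b2"])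
      (use p1[of r] n1[of r] p2[of r] n2[of r] x[of r] z[of r] in
        \<open>simp_all add: T nsm_add_right nsm_diff_right nsm_mult_left nsm_mult_right algebra_simps\<close>)
  show ?thesis
    by (rule polynomial_annihilator[of _ "T x" b1 a1 b2 a2]) (use x c in blast)+
qed

text \<open>Modulo the two-sided ideal \<open>N\<close>, the ring is semiprime, has no 2- or
  3-torsion and satisfies \<open>(ad z)^3 = 0\<close>. The exponent is lowered to 2 and then to
  1.\<close>

lemma engel3_annihilated:
  fixes a :: 'a
  assumes T: "\<And>r y z. a * r * ad z (ad z (ad z y)) = 0"
  shows "a * r * ad z y = 0"
proof -
  define N where "N = {b. \<forall>r. a * r * b = 0}"
  have N_add: "b + c \<in> N" if "b \<in> N" "c \<in> N" for b c using that by (simp add: N_def distrib_left)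
  have N_diff: "b - c \<in> N" if "b \<in> N" "c \<in> N" for b c using that by (simp add: N_def right_diff_distrib)
  have N_right: "b * c \<in> N" if "b \<in> N" for b c
    using that by (simp add: N_def mult.assoc[symmetric])
  have N_left: "c * b \<in> N" if "b \<in> N" for b c
    unfolding N_def
  proof (intro CollectI allI)
    fix r
    have "a * (r * c) * b = 0" using that unfolding N_def by blast
    then show "a * r * (c * b) = 0" by (simp only: mult.assoc)
  qed
  have N_two: "b \<in> N" if "b + b \<in> N" for b
    unfolding N_def
  proof (intro CollectI allI)
    fix r
    have "a * r * b + a * r * b = 0" using that by (simp add: N_def distrib_left)
    then show "a * r * b = 0" by (rule two_cancel)
  qed
  have N_three: "b \<in> N" if "b + b + b \<in> N" for b
    unfolding N_def
  proof (intro CollectI allI)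
    fix r
    have "a * r * b + a * r * b + a * r * b = 0" using that by (simp add: N_def distrib_left)
    then show "a * r * b = 0" by (rule three_cancel)
  qed
  have N_semiprime: "b \<in> N" if b: "\<And>r. b * r * b \<in> N" for b
    unfolding N_def
  proof (intro CollectI allI, rule semiprimeD)
    fix s r
    have "a * s * (b * (r * a * s) * b) = 0" using b unfolding N_def by blast
    then show "a * s * b * r * (a * s * b) = 0" by (simp only: mult.assoc)
  qed
  have T: "ad z (ad z (ad z y)) \<in> N" for z y using T by (simp add: N_def)
  have ad2: "ad z (ad z y) \<in> N" for z y
  proof -
    let ?\<delta> = "ad z"
    \<comment> \<open>the part of \<open>(ad z)^3 y\<close> linear in \<open>w\<close> under replacing \<open>z\<close> by \<open>z + w\<close>;
      putting \<open>z * w\<close> for \<open>w\<close> is the key step\<close>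
    let ?l = "\<lambda>w. ad w (?\<delta> (?\<delta> y)) + ?\<delta> (ad w (?\<delta> y)) + ?\<delta> (?\<delta> (ad w y))"
    have l: "?l w \<in> N" for w
    proof (rule N_two)
      have "?l w + ?l w = ad (z + w) (ad (z + w) (ad (z + w) y)) - ad (z - w) (ad (z - w) (ad (z - w) y))
          - ad w (ad w (ad w y)) - ad w (ad w (ad w y))"
        by (simp add: ad_left_add ad_left_diff ad_simps algebra_simps)
      then show "?l w + ?l w \<in> N" by (simp only: N_diff T)
    qed
    have "?\<delta> (?\<delta> y) * ?\<delta> w \<in> N" for w
    proof -
      let ?p = "?\<delta> (?\<delta> y) * ?\<delta> w" and ?q = "?\<delta> y * ?\<delta> (?\<delta> w)"
      have "(?p + ?q) + (?p + ?q) + (?p + ?q)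
          = ?\<delta> (?\<delta> (?\<delta> (y * w))) - ?\<delta> (?\<delta> (?\<delta> y)) * w - y * ?\<delta> (?\<delta> (?\<delta> w))"
        by (simp add: ad_simps algebra_simps)
      then have "(?p + ?q) + (?p + ?q) + (?p + ?q) \<in> N" by (simp only: N_diff N_left N_right T)
      then have pq: "?p + ?q \<in> N" by (rule N_three)
      have "?p + ?p = (((?l (z * w) - z * ?l w - ?\<delta> (?\<delta> (?\<delta> y)) * w) - ?\<delta> (?\<delta> (?\<delta> y)) * w)
          - ?\<delta> (?\<delta> (?\<delta> y)) * w) - (?p + ?q)"
        by (simp add: ad_left_mult ad_simps algebra_simps)
      then have "?p + ?p \<in> N" by (simp only: N_diff N_left N_right T l pq)
      then show ?thesis by (rule N_two)
    qed
    note p = this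
    \<comment> \<open>Taking \<open>w * v\<close> for \<open>w\<close> inserts an arbitrary factor;
      the case \<open>v = ad z y\<close> is what semiprimeness modulo \<open>N\<close>
      requires.\<close>
    have "?\<delta> (?\<delta> y) * w * ?\<delta> v \<in> N" for w v
    proof -
      have "?\<delta> (?\<delta> y) * w * ?\<delta> v = ?\<delta> (?\<delta> y) * ?\<delta> (w * v) - ?\<delta> (?\<delta> y) * ?\<delta> w * v"
        by (simp add: ad_simps algebra_simps)
      then show ?thesis by (simp only: N_diff N_right p)
    qed
    then show ?thesis by (rule N_semiprime)
  qed
  have p: "ad z y * ad z w \<in> N" for w y z
  proof (rule N_two)
    have "ad z y * ad z w + ad z y * ad z w = ad z (ad z (y * w)) - ad z (ad z y) * w - y * ad z (ad z w)"
      by (simp add: ad_simps algebra_simps)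
    then show "ad z y * ad z w + ad z y * ad z w \<in> N" by (simp only: N_diff N_left N_right ad2)
  qed
  have "ad z y * w * ad z v \<in> N" for w v
  proof -
    have "ad z y * w * ad z v = ad z y * ad z (w * v) - ad z y * ad z w * v"
      by (simp add: ad_simps algebra_simps)
    then show ?thesis by (simp only: N_diff N_right p)
  qed
  then have "ad z y \<in> N" by (rule N_semiprime)
  then show ?thesis by (simp add: N_def)
qed

section \<open>Jordan derivations are commuting, central, and derivations\<close>

text \<open>\<open>ad u (D u)\<close> is quadratic in \<open>u\<close>, so decoupling frees the
  triple commutator from \<open>x\<close>. The Engel lemma then applies to the commutator of
  \<open>D x\<close> with \<open>x\<close> itself.\<close>

lemma mn_jordan_commuting:
  fixes D :: "'a \<Rightarrow> 'a"
  assumes jord: "mn_jordan_derivation m n D"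
  shows "ad x (D x) = 0"
proof -
  have add: "D (u + v) = D u + D v" for u v
    using jord by (simp add: mn_jordan_derivation_def additive_def)
  have diff: "D (u - v) = D u - D v" for u v
    using jord by (simp add: mn_jordan_derivation_def additive_diff)
  have 0: "ad u (D u) * r * ad u (ad u (ad u y)) = 0" for u r y
    by (intro annihilates_ad2_imp_ad3 gpi_imp_annihilates_ad2 mn_jordan_gpi jord)
  have "ad x (D x) * r * ad z (ad z (ad z y)) = 0" for r y z
  proof (rule ad3_annihilator_decouple)
    show "(ad x (D x) + (ad x (D z) + ad z (D x)) + ad z (D z)) * r
        * ad (x + z) (ad (x + z) (ad (x + z) y)) = 0" for r
      using 0[of "x + z" r y] by (simp add: add ad_left_add[of x z "D _"] ad_simps add_ac)
    show "(ad x (D x) - (ad x (D z) + ad z (D x)) + ad z (D z)) * r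
        * ad (x - z) (ad (x - z) (ad (x - z) y)) = 0" for r
    proof -
      have "ad (x - z) (D (x - z)) = ad x (D x) - (ad x (D z) + ad z (D x)) + ad z (D z)"
        by (simp add: diff ad_left_diff ad_simps algebra_simps)
      then show ?thesis using 0[of "x - z" r y] by simp
    qed
    show "(ad x (D x) + 2 \<cdot> (ad x (D z) + ad z (D x)) + 2 \<cdot> 2 \<cdot> ad z (D z)) * r
        * ad (x + (z + z)) (ad (x + (z + z)) (ad (x + (z + z)) y)) = 0" for r
    proof -
      have "ad (x + (z + z)) (D (x + (z + z)))
          = ad x (D x) + 2 \<cdot> (ad x (D z) + ad z (D x)) + 2 \<cdot> 2 \<cdot> ad z (D z)"
        by (simp add: add ad_left_add ad_simps nsm_two algebra_simps)
      then show ?thesis using 0[of "x + (z + z)" r y] by simp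
    qed
    show "(ad x (D x) - 2 \<cdot> (ad x (D z) + ad z (D x)) + 2 \<cdot> 2 \<cdot> ad z (D z)) * r
        * ad (x - (z + z)) (ad (x - (z + z)) (ad (x - (z + z)) y)) = 0" for r
    proof -
      have "ad (x - (z + z)) (D (x - (z + z)))
          = ad x (D x) - 2 \<cdot> (ad x (D z) + ad z (D x)) + 2 \<cdot> 2 \<cdot> ad z (D z)"
        by (simp add: add diff ad_left_add ad_left_diff ad_simps nsm_two algebra_simps)
      then show ?thesis using 0[of "x - (z + z)" r y] by simp
    qed
  qed (rule 0)+
  then have "ad x (D x) * r * ad x (D x) = 0" for r by (rule engel3_annihilated)
  then show ?thesis by (rule semiprimeD)
qed

lemma mn_jordan_annihilates_commutators:
  fixes D :: "'a \<Rightarrow> 'a"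
  assumes jord: "mn_jordan_derivation m n D"
  shows "D x * r * ad z y = 0"
proof -
  have add: "D (u + v) = D u + D v" for u v
    using jord by (simp add: mn_jordan_derivation_def additive_def)
  have diff: "D (u - v) = D u - D v" for u v
    using jord by (simp add: mn_jordan_derivation_def additive_diff)
  note comm = mn_jordan_commuting[OF jord]
  have comm2: "ad u (D v) + ad v (D u) = 0" for u v
    using comm[of "u + v"] comm[of u] comm[of v] by (simp add: add ad_left_add ad_simps add_ac)
  have jordan: "D (u * v + v * u) = D u * v + v * D u + D v * u + u * D v" for u v
  proof -
    have "D u * v + D v * u - (u * D v + v * D u) = ad u (D v) + ad v (D u)"
      by (simp add: ad_def algebra_simps)
    then have eq: "D u * v + D v * u = u * D v + v * D u" using comm2[of u v] by simp
    let ?q = "u * D v + v * D u"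
    have "(m + n) \<cdot> D (u * v + v * u) = (2 * m) \<cdot> ?q + (2 * n) \<cdot> ?q"
      unfolding mn_jordan_linearized[OF jord] eq ..
    then have "m \<cdot> (D (u * v + v * u) - (?q + ?q)) + n \<cdot> (D (u * v + v * u) - (?q + ?q)) = 0"
      by (simp add: nsm_simps algebra_simps)
    then have "D (u * v + v * u) - (?q + ?q) = 0" by (rule add_cancel)
    then have "D (u * v + v * u) = ?q + ?q" by simp
    also have "\<dots> = D u * v + D v * u + ?q" unfolding eq ..
    finally show ?thesis by (simp add: algebra_simps)
  qed
  have anti: "D u * ad u v + ad u v * D u = 0" for u v
  proof -
    \<comment> \<open>This is \<open>comm2\<close> for \<open>u\<close> and \<open>?j\<close>, with
      \<open>D ?j\<close> expanded by \<open>jordan\<close>; the terms in \<open>D v\<close> cancel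
      by \<open>comm2\<close> for \<open>u\<close> and \<open>v\<close>.\<close>
    let ?j = "u * v + v * u"
    have "D u * ad u v + ad u v * D u
        = (ad u (D u * v + v * D u + D v * u + u * D v) + ad ?j (D u))
          - ((ad u (D v) + ad v (D u)) * u + u * (ad u (D v) + ad v (D u)))
          - 2 \<cdot> (ad u (D u) * v + v * ad u (D u))"
      by (simp add: ad_def nsm_two algebra_simps)
    also have "\<dots> = 0" unfolding jordan[symmetric] comm2 comm by simp
    finally show ?thesis .
  qed
  have "D u * ad u (ad u v) = 0" for u v
  proof -
    let ?p = "D u * ad u (ad u v)" and ?q = "ad u (ad u v) * D u"
    \<comment> \<open>Anticommutation turns the polynomial identity into
      \<open>(m+n)^2 ?p = 0\<close>.\<close>
    have q: "?q = - ?p" using anti[of u "ad u v"] by (simp add: eq_neg_iff_add_eq_0 add.commute)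
    have "m \<cdot> (m + n) \<cdot> ?p + n \<cdot> (m + n) \<cdot> ?p = 0"
      using mn_jordan_gpi[OF jord, of u v] unfolding q comm by (simp add: nsm_minus_right add_eq_0_iff2)
    then have "(m + n) \<cdot> ?p = 0" by (rule add_cancel)
    then show ?thesis unfolding nsm_add_left by (rule add_cancel)
  qed
  then have 0: "D u * r * ad u (ad u (ad u y)) = 0" for u r y by (rule annihilates_ad2_imp_ad3)
  have "D x * r * ad z (ad z (ad z y)) = 0" for r y z
  proof (rule ad3_annihilator_decouple[where ?a1.0 = "D z" and ?a2.0 = 0])
    show "(D x + D z + 0) * r * ad (x + z) (ad (x + z) (ad (x + z) y)) = 0" for r
      using 0[of "x + z" r y] by (simp add: add)
    show "(D x - D z + 0) * r * ad (x - z) (ad (x - z) (ad (x - z) y)) = 0" for r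
      using 0[of "x - z" r y] by (simp add: diff)
    show "(D x + 2 \<cdot> D z + 2 \<cdot> 2 \<cdot> 0) * r
        * ad (x + (z + z)) (ad (x + (z + z)) (ad (x + (z + z)) y)) = 0" for r
      using 0[of "x + (z + z)" r y] by (simp add: add nsm_two)
    show "(D x - 2 \<cdot> D z + 2 \<cdot> 2 \<cdot> 0) * r
        * ad (x - (z + z)) (ad (x - (z + z)) (ad (x - (z + z)) y)) = 0" for r
      using 0[of "x - (z + z)" r y] by (simp add: add diff nsm_two)
  qed (use 0 in simp_all)
  then show ?thesis by (rule engel3_annihilated)
qed

lemma mn_jordan_central:
  fixes D :: "'a \<Rightarrow> 'a"
  assumes jord: "mn_jordan_derivation m n D"
  shows "D x * z = z * D x"
proof -
  have 0: "D x * r * ad z (D x) = 0" for r by (rule mn_jordan_annihilates_commutators[OF jord])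
  have "ad z (D x) * r * ad z (D x) = D x * (z * r) * ad z (D x) - z * (D x * r * ad z (D x))" for r
    by (subst ad_def) (simp only: left_diff_distrib mult.assoc)
  then have "ad z (D x) = 0" by (intro semiprimeD[of "ad z (D x)"]) (simp only: 0 mult_zero_right diff_zero)
  then show ?thesis by (simp add: ad_def)
qed

text \<open>For central \<open>D\<close>, the Jordan rule determines \<open>D\<close> only on
  symmetrized products, so the point is that \<open>D\<close> vanishes on commutators.\<close>

lemma mn_jordan_imp_derivation:
  fixes D :: "'a \<Rightarrow> 'a"
  assumes jord: "mn_jordan_derivation m n D"
  shows "derivation D"
proof -
  have D: "additive D" using jord by (simp add: mn_jordan_derivation_def)
  then have add: "D (u + v) = D u + D v" for u v by (simp add: additive_def)
  note diff = additive_diff[OF D]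
  note central = mn_jordan_central[OF jord]
  have Dad: "D u * ad v w = 0" for u v w
  proof (rule semiprimeD)
    fix r
    have "D u * (ad v w * r * D u) * ad v w = 0" by (rule mn_jordan_annihilates_commutators[OF jord])
    then show "D u * ad v w * r * (D u * ad v w) = 0" by (simp only: mult.assoc)
  qed
  have jordan: "D (u * v + v * u) = 2 \<cdot> (D u * v + D v * u)" for u v
  proof -
    let ?q = "D u * v + D v * u"
    have "(m + n) \<cdot> D (u * v + v * u) = (2 * m) \<cdot> ?q + (2 * n) \<cdot> ?q"
      unfolding mn_jordan_linearized[OF jord] central[of v u, symmetric] central[of u v, symmetric]
      by (simp only: add.commute)
    then have "m \<cdot> (D (u * v + v * u) - 2 \<cdot> ?q) + n \<cdot> (D (u * v + v * u) - 2 \<cdot> ?q) = 0"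
      by (simp add: nsm_simps algebra_simps)
    then have "D (u * v + v * u) - 2 \<cdot> ?q = 0" by (rule add_cancel)
    then show ?thesis by simp
  qed
  have "D (ad v u) = 0" for u v
  proof -
    let ?w = "ad v u"
    have D2: "D (ad z ?w) = 0" for z
    proof -
      \<comment> \<open>\<open>[[u, v], z] = u o (v o z) - v o (u o z)\<close> expresses the double
        commutator by symmetrized products, where \<open>jordan\<close> applies.\<close>
      have "ad z ?w = (u * (v * z + z * v) + (v * z + z * v) * u) - (v * (u * z + z * u) + (u * z + z * u) * v)"
        by (simp add: ad_def algebra_simps)
      then have "D (ad z ?w) = 2 \<cdot> (D u * (v * z + z * v) + 2 \<cdot> (D v * z + D z * v) * u)
          - 2 \<cdot> (D v * (u * z + z * u) + 2 \<cdot> (D u * z + D z * u) * v)"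
        by (simp only: diff jordan)
      also have "\<dots> = 2 \<cdot> (D u * ad z v) - 2 \<cdot> (D v * ad z u) + 2 \<cdot> 2 \<cdot> (D z * ad u v)"
        by (simp add: ad_def nsm_two nsm_mult_left algebra_simps)
      finally show ?thesis by (simp add: Dad)
    qed
    have w: "D (?w * z) = D ?w * z" for z
    proof -
      have "D (?w * z) + D (?w * z) = D (?w * z + z * ?w) + D (ad z ?w)"
        by (simp add: ad_def add[symmetric] algebra_simps)
      also have "\<dots> = D ?w * z + D ?w * z" unfolding jordan D2 Dad by (simp add: nsm_two)
      finally have "(D (?w * z) - D ?w * z) + (D (?w * z) - D ?w * z) = 0" by (simp add: algebra_simps)
      then have "D (?w * z) - D ?w * z = 0" by (rule two_cancel)
      then show ?thesis by simp
    qed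
    \<comment> \<open>By \<open>w\<close> the square is \<open>D (?w * D ?w)\<close>, and
      \<open>Dad\<close> makes its argument zero; a central element of square zero vanishes.\<close>
    have "D ?w * D ?w = D (?w * D ?w)" by (simp only: w)
    also have "\<dots> = 0" unfolding central[symmetric] Dad by (rule additive_zero[OF D])
    finally have "D ?w * r * D ?w = 0" for r
      unfolding central[of _ r] by (simp add: mult.assoc)
    then show ?thesis by (rule semiprimeD)
  qed
  then have sym: "D (u * v) = D (v * u)" for u v
    using diff[of "u * v" "v * u"] unfolding ad_def by simp
  have "D (u * v) = D u * v + u * D v" for u v
  proof -
    have "D (u * v) + D (u * v) = D (u * v + v * u)" unfolding add by (simp add: sym)
    then have "(D (u * v) - (D u * v + D v * u)) + (D (u * v) - (D u * v + D v * u)) = 0"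
      unfolding jordan nsm_two by (simp add: algebra_simps)
    then have "D (u * v) - (D u * v + D v * u) = 0" by (rule two_cancel)
    then show ?thesis by (simp add: central)
  qed
  then show ?thesis using D by (simp add: derivation_def)
qed

end

theorem theorem2p4:
  fixes m n :: nat and F :: "'a::ring \<Rightarrow> 'a"
  assumes "m \<ge> 1" and "n \<ge> 1" and "m \<noteq> n"
    and "semiprime TYPE('a)"
    and "torsion_free TYPE('a) (m * n * (m + n) * nat \<bar>int n - int m\<bar>)"
    and "gen_mn_jordan_derivation m n F"
  shows "derivation F \<and> F ` UNIV \<subseteq> center"
proof -
  interpret torsion_free_semiprime m n "TYPE('a)"
    using assms(4) six_dvd_torsion_number[of m n]
    by unfold_locales (auto intro: torsion_free_dvd[OF assms(5)])
  obtain D where jord: "mn_jordan_derivation m n D"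
    and F: "\<And>x. (m + n) \<cdot> F (x * x) = (2 * m) \<cdot> (F x * x) + (2 * n) \<cdot> (x * D x)"
    and add: "additive F"
    using assms(6) unfolding gen_mn_jordan_derivation_def by blast
  have D: "(m + n) \<cdot> D (x * x) = (2 * m) \<cdot> (D x * x) + (2 * n) \<cdot> (x * D x)" for x
    using jord unfolding mn_jordan_derivation_def by blast
  \<comment> \<open>The terms \<open>2n x D(x)\<close> in the two identities cancel, leaving the
    one-sided identity for the difference.\<close>
  have "F x - D x = 0" for x
  proof (rule additive_left_eigen_zero[of "\<lambda>x. F x - D x"])
    show "additive (\<lambda>x. F x - D x)"
      using add jord by (simp add: additive_def mn_jordan_derivation_def algebra_simps)
    show "(m + n) \<cdot> (F (u * u) - D (u * u)) = (2 * m) \<cdot> ((F u - D u) * u)" for u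
      unfolding nsm_diff_right F D left_diff_distrib by simp
  qed
  then have "F = D" by auto
  then show ?thesis
    using mn_jordan_imp_derivation[OF jord] mn_jordan_central[OF jord] by (auto simp: center_def)
qed

end
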